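(* Let $\ell\in\{\ell_{\log},\ell_{\exp}\}$ and let $w_0=0$, $w_{j+1}=w_j-\eta_j\nabla\mathcal R(w_j)$ with step sizes $0<\eta_j\le1$. Then for any $t\ge1$, $$\mathcal R(w_t)-\inf_{w\in\mathbb R^d}\mathcal R(w)\le\frac{\exp(|\bar v|)}{t}+\frac{|\bar v|^2+\ln(t)^2/\gamma^2}{2\sum_{j=0}^{t-1}\eta_j}.$$
   Context: $|\cdot|$ is the Euclidean norm. $A\in\mathbb R^{n\times d}$ is a data matrix with rows $A_i=-y_ix_i^\top$ satisfying $\max_i|A_i|\le1$. $\ell_{\exp}(z)=e^z$, $\ell_{\log}(z)=\ln(1+e^z)$; for a vector $v$ of any dimension $L(v)=\sum_i\ell(v_i)$; $\mathcal R(w)=L(Aw)/n$. Row $i$ of $A$ is placed in $A_c$ if there is $u\in\mathbb R^d$ with $Au\le0$ coordinate-wise and $(Au)_i<0$, otherwise in $A_S$. $S$ is the span of the rows of $A_S$ ($\{0\}$ if there are none). $\bar v$ is the unique minimizer over $S$ of $v\mapsto L(A_Sv)$ ($\bar v=0$ if $S=\{0\}$); one has $\inf_wL(Aw)=L(A_S\bar v)$. $A_\perp$ has as rows the orthogonal projections of the rows of $A_c$ onto $S^\perp$. If $A_c$ is nonempty, $\gamma=-\min\{\max_i(A_\perp u)_i:|u|=1\}>0$; if $A_c$ is empty, the term $\ln(t)^2/\gamma^2$ is read as $0$. *)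

theory Defs
  imports "HOL-Analysis.Analysis"
begin

definition loss_exp :: "real \<Rightarrow> real" where
  "loss_exp z = exp z"

definition loss_log :: "real \<Rightarrow> real" where
  "loss_log z = ln (1 + exp z)"

text \<open>
  A submatrix of \<open>A\<close> formed by some of its rows is represented by the set \<open>I\<close> of its row indices.
  Thus \<open>total_loss l I (A *v w)\<close> is the summed loss of the product of that submatrix with \<open>w\<close>,
  and \<open>I = UNIV\<close> gives the loss of the full vector \<open>A *v w\<close>.
\<close>

definition total_loss :: "(real \<Rightarrow> real) \<Rightarrow> 'n::finite set \<Rightarrow> real^'n \<Rightarrow> real" where
  "total_loss l I v = (\<Sum>i\<in>I. l (v $ i))"

definition risk :: "(real \<Rightarrow> real) \<Rightarrow> real^'d^'n \<Rightarrow> real^'d \<Rightarrow> real" where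
  "risk l A w = total_loss l UNIV (A *v w) / real CARD('n)"

definition gradient :: "('a::real_inner \<Rightarrow> real) \<Rightarrow> 'a \<Rightarrow> 'a" where
  "gradient f w = (THE g. GDERIV f w :> g)"

definition rows_c :: "real^'d^'n \<Rightarrow> 'n set" where
  "rows_c A = {i. \<exists>u. (\<forall>k. (A *v u) $ k \<le> 0) \<and> (A *v u) $ i < 0}"

definition rows_S :: "real^'d^'n \<Rightarrow> 'n set" where
  "rows_S A = - rows_c A"

definition span_S :: "real^'d^'n \<Rightarrow> (real^'d) set" where
  "span_S A = span ((\<lambda>i. row i A) ` rows_S A)"

definition vbar :: "(real \<Rightarrow> real) \<Rightarrow> real^'d^'n \<Rightarrow> real^'d" where
  "vbar l A = (THE v. is_arg_min (\<lambda>v. total_loss l (rows_S A) (A *v v)) (\<lambda>v. v \<in> span_S A) v)"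

definition orth_proj :: "'a::euclidean_space set \<Rightarrow> 'a \<Rightarrow> 'a" where
  "orth_proj T x = (THE p. p \<in> T \<and> (\<forall>y\<in>T. orthogonal (x - p) y))"

text \<open>Only the rows of \<open>A_perp A\<close> with index in \<open>rows_c A\<close> are relevant.\<close>

definition A_perp :: "real^'d^'n \<Rightarrow> real^'d^'n" where
  "A_perp A = (\<chi> i. orth_proj (orthogonal_comp (span_S A)) (row i A))"

text \<open>
  If \<open>rows_c A\<close> is nonempty, the infimum is a minimum, by compactness of the unit sphere.
  If it is empty, the value is meaningless.
\<close>

definition margin :: "real^'d^'n \<Rightarrow> real" where
  "margin A = - (INF u\<in>{u. norm u = 1}. MAX i\<in>rows_c A. (A_perp A *v u) $ i)"

end

theory Submission
  imports Defs
begin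

text \<open>
  Each step satisfies the descent inequality
  \<open>R (w - \<eta> g) \<le> R w - \<eta> / 2 * |g|\<^sup>2\<close> with \<open>g\<close> the gradient at \<open>w\<close>; combined with convexity and
  telescoping of \<open>|w\<^sub>j - z|\<^sup>2\<close> this gives \<open>R w\<^sub>t - R z \<le> |z|\<^sup>2 / (2 * \<Sum>\<eta>\<^sub>j)\<close> for every \<open>z\<close>.
  The bound follows from the choice \<open>z = vbar + (ln t / \<gamma>) u\<close>, where \<open>u\<close> is orthogonal to \<open>S\<close>,
  \<open>|u| \<le> 1\<close> and every row in \<open>A\<^sub>c\<close> has inner product at most \<open>-\<gamma>\<close> with \<open>u\<close>: adding a multiple
  of \<open>u\<close> does not change the loss of \<open>A\<^sub>S\<close> and makes each remaining loss at most \<open>exp |vbar| / t\<close>.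
\<close>

section \<open>Row-wise form of the risk and its gradient\<close>

lemma row_inner: "(A *v u) $ i = row i A \<bullet> u"
  by (simp add: matrix_vector_mul_component row_def vec_lambda_eta)

lemma risk_eq:
  fixes A :: "real^'d^'n"
  shows "risk l A w = (\<Sum>i\<in>UNIV. l (row i A \<bullet> w)) / real CARD('n)"
  by (simp add: risk_def total_loss_def row_inner)

lemma gradient_eqI:
  assumes "GDERIV f x :> D"
  shows "gradient f x = D"
  unfolding gradient_def
proof (rule the_equality)
  show "GDERIV f x :> D" by (rule assms)
next
  fix g assume "GDERIV f x :> g"
  then have "(\<lambda>h. inner h g) = (\<lambda>h. inner h D)"
    using assms unfolding gderiv_def by (rule has_derivative_unique)
  \<comment> \<open>Both linear functionals agree, so evaluating them at \<open>g - D\<close> will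
    show that this vector is orthogonal to itself.\<close>
  then have "inner (g - D) g = inner (g - D) D"
    by metis
  then have "inner (g - D) (g - D) = 0"
    by (simp add: inner_diff_right)
  then show "g = D"
    by simp
qed

text \<open>Closed form that stands in for the definite description
  \<open>gradient (risk l A)\<close>; the derivative \<open>l'\<close> is a parameter so that both
  losses share it.\<close>

definition risk_grad :: "(real \<Rightarrow> real) \<Rightarrow> real^'d^'n \<Rightarrow> real^'d \<Rightarrow> real^'d" where
  "risk_grad l' A w = (\<Sum>i\<in>UNIV. l' (row i A \<bullet> w) *\<^sub>R row i A) /\<^sub>R real CARD('n)"

lemma inner_risk_grad:
  fixes A :: "real^'d^'n"
  shows "risk_grad l' A w \<bullet> u = (\<Sum>i\<in>UNIV. l' (row i A \<bullet> w) * (row i A \<bullet> u)) / real CARD('n)"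
  by (simp add: risk_grad_def inner_sum_left field_simps)

lemma gradient_risk:
  fixes A :: "real^'d^'n"
  assumes "\<And>z. DERIV l z :> l' z"
  shows "gradient (risk l A) w = risk_grad l' A w"
proof (rule gradient_eqI)
  have "GDERIV (\<lambda>w. row i A \<bullet> w) w :> row i A" for i
    unfolding gderiv_def by (auto intro!: derivative_eq_intros simp: inner_commute)
  from GDERIV_DERIV_compose[OF this assms]
  have "((\<lambda>w. l (row i A \<bullet> w)) has_derivative (\<lambda>h. l' (row i A \<bullet> w) * (row i A \<bullet> h))) (at w)" for i
    by (simp add: gderiv_def inner_commute)
  then have "((\<lambda>w. (\<Sum>i\<in>UNIV. l (row i A \<bullet> w)) / real CARD('n)) has_derivative
      (\<lambda>h. (\<Sum>i\<in>UNIV. l' (row i A \<bullet> w) * (row i A \<bullet> h)) / real CARD('n))) (at w)"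
    by (intro bounded_linear.has_derivative[OF bounded_linear_divide] has_derivative_sum)
  then show "GDERIV (risk l A) w :> risk_grad l' A w"
    unfolding gderiv_def risk_eq[abs_def] inner_commute[of _ "risk_grad l' A w"] inner_risk_grad .
qed

section \<open>Telescoping for gradient descent\<close>

text \<open>When the squared distance of \<open>w (Suc j)\<close> to \<open>z\<close> is expanded,
  the tangent inequality bounds the cross term and the descent inequality cancels the quadratic term
  exactly. The gaps weighted by \<open>2 * \<eta> j\<close> then telescope, and since the values
  decrease, the last iterate may replace all earlier ones.\<close>

lemma descent_telescoping:
  fixes f :: "'a::real_inner \<Rightarrow> real" and w :: "nat \<Rightarrow> 'a"
  assumes step: "\<And>j. w (Suc j) = w j - \<eta> j *\<^sub>R g (w j)"
    and pos: "\<And>j. 0 < \<eta> j"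
    and descent: "\<And>j. f (w (Suc j)) \<le> f (w j) - \<eta> j / 2 * (norm (g (w j)))\<^sup>2"
    and tangent: "\<And>v z. f v + g v \<bullet> (z - v) \<le> f z"
    and "t \<ge> 1"
  shows "f (w t) - f z \<le> (norm (w 0 - z))\<^sup>2 / (2 * (\<Sum>j<t. \<eta> j))"
proof -
  have "f (w (Suc j)) \<le> f (w j)" for j
  proof -
    have "0 \<le> \<eta> j / 2 * (norm (g (w j)))\<^sup>2"
      using pos[of j] by simp
    then show ?thesis using descent[of j] by linarith
  qed
  then have mono: "f (w n) \<le> f (w m)" if "m \<le> n" for m n
    using lift_Suc_antimono_le[of "f \<circ> w"] that by simp
  have one: "2 * \<eta> j * (f (w (Suc j)) - f z) \<le> (norm (w j - z))\<^sup>2 - (norm (w (Suc j) - z))\<^sup>2" for j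
  proof -
    let ?g = "g (w j)"
    have diff: "w (Suc j) - z = (w j - z) - \<eta> j *\<^sub>R ?g"
      by (simp add: step)
    have "(norm (w (Suc j) - z))\<^sup>2
        = (norm (w j - z))\<^sup>2 - 2 * \<eta> j * (?g \<bullet> (w j - z)) + (\<eta> j)\<^sup>2 * (norm ?g)\<^sup>2"
      unfolding power2_norm_eq_inner diff
      by (simp add: inner_diff_left inner_diff_right inner_commute power2_eq_square algebra_simps)
    moreover have "2 * \<eta> j * (f (w j) - f z) \<le> 2 * \<eta> j * (?g \<bullet> (w j - z))"
      using tangent[of "w j" z] pos[of j] by (intro mult_left_mono) (auto simp: inner_diff_right)
    moreover have "2 * \<eta> j * f (w (Suc j)) \<le> 2 * \<eta> j * (f (w j) - \<eta> j / 2 * (norm ?g)\<^sup>2)"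
      using descent[of j] pos[of j] by (intro mult_left_mono) auto
    ultimately show ?thesis
      by (simp add: algebra_simps power2_eq_square)
  qed
  have "(\<Sum>j<t. 2 * \<eta> j * (f (w t) - f z)) \<le> (\<Sum>j<t. 2 * \<eta> j * (f (w (Suc j)) - f z))"
    using mono pos by (intro sum_mono mult_left_mono) (auto simp: less_imp_le)
  also have "\<dots> \<le> (\<Sum>j<t. (norm (w j - z))\<^sup>2 - (norm (w (Suc j) - z))\<^sup>2)"
    by (intro sum_mono one)
  also have "\<dots> = (norm (w 0 - z))\<^sup>2 - (norm (w t - z))\<^sup>2"
    by (rule sum_lessThan_telescope')
  also have "\<dots> \<le> (norm (w 0 - z))\<^sup>2"
    by simp
  finally have "(f (w t) - f z) * (2 * (\<Sum>j<t. \<eta> j)) \<le> (norm (w 0 - z))\<^sup>2"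
    by (simp add: sum_distrib_left sum_distrib_right algebra_simps)
  moreover have "0 < (\<Sum>j<t. \<eta> j)"
    using pos \<open>t \<ge> 1\<close> by (intro sum_pos) (auto simp: lessThan_empty_iff)
  ultimately show ?thesis
    by (simp add: pos_le_divide_eq)
qed

section \<open>Descent inequality for the exponential loss\<close>

text \<open>By convexity \<open>exp\<close> lies below its chord between
  \<open>- (\<eta> * k)\<close> and \<open>\<eta> * k\<close>; \<open>cosh\<close> and
  \<open>sinh\<close> are the mean and the half-difference of the end values. The bound is affine in
  \<open>a\<close>, so it can be averaged over the rows.\<close>

lemma exp_le_chord:
  fixes a k :: real
  assumes "\<bar>a\<bar> \<le> k" "0 < k"
  shows "exp (- (\<eta> * a)) \<le> cosh (\<eta> * k) - a / k * sinh (\<eta> * k)"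
proof -
  define u where "u = a / k"
  have u: "\<bar>u\<bar> \<le> 1" "a = u * k"
    using assms by (auto simp: u_def abs_divide)
  \<comment> \<open>Weight that places \<open>- (\<eta> * a)\<close> between the two end
    points.\<close>
  define \<theta> where "\<theta> = (1 + u) / 2"
  have \<theta>: "0 \<le> \<theta>" "\<theta> \<le> 1"
    using u by (auto simp: \<theta>_def)
  have "exp ((1 - \<theta>) *\<^sub>R (\<eta> * k) + \<theta> *\<^sub>R (- (\<eta> * k)))
      \<le> (1 - \<theta>) * exp (\<eta> * k) + \<theta> * exp (- (\<eta> * k))"
    using \<theta> by (intro convex_onD[OF exp_convex]) auto
  moreover have "(1 - \<theta>) *\<^sub>R (\<eta> * k) + \<theta> *\<^sub>R (- (\<eta> * k)) = - (\<eta> * a)"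
    by (simp add: \<theta>_def u field_simps)
  moreover have "(1 - \<theta>) * exp (\<eta> * k) + \<theta> * exp (- (\<eta> * k))
      = cosh (\<eta> * k) - a / k * sinh (\<eta> * k)"
    unfolding u_def[symmetric] by (simp add: \<theta>_def cosh_def sinh_def field_simps)
  ultimately show ?thesis
    by simp
qed

text \<open>The difference of the sides vanishes at 0 and has derivative
  \<open>s * (cosh s - 1)\<close>. This lets the first-order gain absorb the growth of
  \<open>cosh\<close> in the descent estimate.\<close>

lemma cosh_sinh_bound:
  fixes s :: real
  assumes "0 \<le> s"
  shows "cosh s - 1 \<le> s * sinh s - s\<^sup>2 / 2"
proof -
  let ?q = "\<lambda>s::real. s * sinh s - s\<^sup>2 / 2 - cosh s + 1"
  have "?q 0 \<le> ?q s"
  proof (rule DERIV_nonneg_imp_nondecreasing[OF assms])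
    fix x :: real assume "0 \<le> x"
    then have "0 \<le> x * (cosh x - 1)"
      by (simp add: cosh_real_ge_1)
    moreover have "DERIV ?q x :> x * (cosh x - 1)"
      by (auto intro!: derivative_eq_intros simp: algebra_simps)
    ultimately show "\<exists>y. DERIV ?q x :> y \<and> 0 \<le> y"
      by blast
  qed
  then show ?thesis by simp
qed

text \<open>Makes the factor \<open>sinh s - s / 2\<close> of the descent estimate nonnegative, so
  that \<open>s\<close> in front of it can be enlarged to \<open>k\<close>.\<close>

lemma le_sinh:
  fixes s :: real
  assumes "0 \<le> s"
  shows "s \<le> sinh s"
proof -
  have "sinh 0 - 0 \<le> sinh s - s"
  proof (rule DERIV_nonneg_imp_nondecreasing[OF assms])
    fix x :: real
    have "DERIV (\<lambda>s. sinh s - s) x :> cosh x - 1"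
      by (auto intro!: derivative_eq_intros)
    then show "\<exists>y. DERIV (\<lambda>s. sinh s - s) x :> y \<and> 0 \<le> y"
      using cosh_real_ge_1[of x] by auto
  qed
  then show ?thesis by simp
qed

lemma abs_row_inner_le:
  assumes "norm (row i A) \<le> 1"
  shows "\<bar>row i A \<bullet> u\<bar> \<le> norm u"
  using Cauchy_Schwarz_ineq2[of "row i A" u] mult_right_mono[OF assms, of "norm u"] by simp

text \<open>
  The exponential loss is not globally smooth. Since \<open>|A\<^sub>i g| \<le> |g| \<le> R w\<close>, the chord bound for
  \<open>exp\<close> replaces the second-order Taylor estimate, and no bound along the whole segment is needed.
\<close>

lemma descent_exp:
  fixes A :: "real^'d^'n"
  assumes A: "\<And>i. norm (row i A) \<le> 1" and R: "risk loss_exp A w \<le> 1"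
    and \<eta>: "0 < \<eta>" "\<eta> \<le> 1"
  shows "risk loss_exp A (w - \<eta> *\<^sub>R risk_grad exp A w)
    \<le> risk loss_exp A w - \<eta> / 2 * (norm (risk_grad exp A w))\<^sup>2"
proof (cases "risk_grad exp A w = 0")
  case False
  define g where "g = risk_grad exp A w"
  define k where "k = norm g"
  define R where "R = risk loss_exp A w"
  define s where "s = \<eta> * k"
  have "0 < k" using False by (simp add: k_def g_def)
  let ?e = "\<lambda>i. exp (row i A \<bullet> w)"
  have Re: "R = (\<Sum>i\<in>UNIV. ?e i) / real CARD('n)"
    by (simp add: R_def risk_eq loss_exp_def)
  have "k = norm (\<Sum>i\<in>UNIV. ?e i *\<^sub>R row i A) / real CARD('n)"
    by (simp add: k_def g_def risk_grad_def divide_inverse mult.commute)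
  also have "\<dots> \<le> (\<Sum>i\<in>UNIV. norm (?e i *\<^sub>R row i A)) / real CARD('n)"
    by (intro divide_right_mono norm_sum) auto
  also have "\<dots> \<le> R"
    unfolding Re using A by (intro divide_right_mono sum_mono) (auto simp: mult_left_le)
  finally have "k \<le> R" .
  have kk: "k\<^sup>2 = (\<Sum>i\<in>UNIV. ?e i * (row i A \<bullet> g)) / real CARD('n)"
    unfolding k_def power2_norm_eq_inner g_def by (rule inner_risk_grad)
  have "risk loss_exp A (w - \<eta> *\<^sub>R g) = (\<Sum>i\<in>UNIV. ?e i * exp (- (\<eta> * (row i A \<bullet> g)))) / real CARD('n)"
    by (simp add: risk_eq loss_exp_def inner_diff_right exp_diff exp_minus field_simps)
  also have "\<dots> \<le> (\<Sum>i\<in>UNIV. ?e i * (cosh s - (row i A \<bullet> g) / k * sinh s)) / real CARD('n)"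
    unfolding s_def using abs_row_inner_le[OF A] \<open>0 < k\<close>
    by (intro divide_right_mono sum_mono mult_left_mono exp_le_chord) (auto simp: k_def)
  \<comment> \<open>By \<open>kk\<close> the terms linear in \<open>row i A \<bullet> g\<close>
    average to \<open>k\<^sup>2\<close>.\<close>
  also have "\<dots> = R * cosh s - k\<^sup>2 / k * sinh s"
    unfolding Re kk
    by (simp add: sum_subtractf right_diff_distrib diff_divide_distrib sum_divide_distrib
        sum_distrib_left sum_distrib_right algebra_simps)
  also have "\<dots> = R * (cosh s - 1) + R - k * sinh s"
    using \<open>0 < k\<close> by (simp add: power2_eq_square algebra_simps)
  also have "\<dots> \<le> R - \<eta> / 2 * k\<^sup>2"
  proof -
    \<comment> \<open>\<open>s \<le> k\<close> is where \<open>\<eta> \<le> 1\<close> enters. After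
      \<open>s\<close> is enlarged to \<open>k\<close>, the term \<open>k * sinh s\<close> cancels
      and \<open>- k * s / 2\<close> remains, which is the claimed decrease.\<close>
    have "0 \<le> s" "s \<le> k"
      using \<eta> \<open>0 < k\<close> by (auto simp: s_def)
    have "R * (cosh s - 1) \<le> 1 * (cosh s - 1)"
      using R cosh_real_ge_1[of s] unfolding R_def by (intro mult_right_mono) auto
    also have "\<dots> \<le> s * (sinh s - s / 2)"
      using cosh_sinh_bound[OF \<open>0 \<le> s\<close>] by (simp add: power2_eq_square algebra_simps)
    also have "\<dots> \<le> k * (sinh s - s / 2)"
      using le_sinh[OF \<open>0 \<le> s\<close>] \<open>0 \<le> s\<close> \<open>s \<le> k\<close> by (intro mult_right_mono) auto
    finally show ?thesis
      by (simp add: s_def power2_eq_square algebra_simps)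
  qed
  finally show ?thesis
    by (simp add: R_def g_def k_def)
qed auto

section \<open>Descent inequality for the logistic loss\<close>

definition sigmoid :: "real \<Rightarrow> real" where
  "sigmoid z = exp z / (1 + exp z)"

lemma one_plus_exp_pos: "0 < 1 + exp (z::real)"
  by (simp add: add_pos_pos)

lemma DERIV_loss_log: "DERIV loss_log z :> sigmoid z"
  unfolding loss_log_def[abs_def] sigmoid_def
  by (auto intro!: derivative_eq_intros simp: one_plus_exp_pos)

lemma DERIV_sigmoid: "DERIV sigmoid z :> sigmoid z * (1 - sigmoid z)"
proof -
  have "1 + exp z \<noteq> 0" using one_plus_exp_pos[of z] by linarith
  then show ?thesis
    unfolding sigmoid_def[abs_def] 
    by (auto intro!: derivative_eq_intros simp: field_simps)
qed

lemma sigmoid_bounds: "0 < sigmoid z" "sigmoid z < 1"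
  using one_plus_exp_pos[of z] by (auto simp: sigmoid_def)

lemma loss_log_tangent: "loss_log a + sigmoid a * (b - a) \<le> loss_log b"
proof -
  have "convex_on UNIV loss_log"
    using DERIV_loss_log DERIV_sigmoid sigmoid_bounds
    by (intro f''_ge0_imp_convex[where f' = sigmoid]) (auto simp: less_imp_le)
  then have "loss_log b - loss_log a \<ge> sigmoid a * (b - a)"
    using DERIV_loss_log by (intro convex_on_imp_above_tangent[where A = UNIV]) auto
  then show ?thesis by simp
qed

text \<open>The second derivative of \<open>loss_log\<close> is at most 1, so
  \<open>z\<^sup>2 / 2 - loss_log z\<close> is convex; its tangent inequality at \<open>a\<close>
  rearranges to the claim.\<close>

lemma loss_log_quadratic: "loss_log b \<le> loss_log a + sigmoid a * (b - a) + (b - a)\<^sup>2 / 2"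
proof -
  let ?h = "\<lambda>z. z\<^sup>2 / 2 - loss_log z"
  have D: "DERIV ?h z :> z - sigmoid z" for z
    by (auto intro!: derivative_eq_intros DERIV_loss_log)
  have D2: "DERIV (\<lambda>z. z - sigmoid z) z :> 1 - sigmoid z * (1 - sigmoid z)" for z
    by (auto intro!: derivative_eq_intros DERIV_sigmoid)
  have "sigmoid z * (1 - sigmoid z) \<le> 1" for z
    using sigmoid_bounds[of z] by (intro mult_le_one) auto
  then have "convex_on UNIV ?h"
    using D D2 by (intro f''_ge0_imp_convex[where f' = "\<lambda>z. z - sigmoid z"]) auto
  then have "?h b - ?h a \<ge> (a - sigmoid a) * (b - a)"
    using D by (intro convex_on_imp_above_tangent[where A = UNIV]) auto
  then show ?thesis
    by (simp add: power2_eq_square field_simps)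
qed

text \<open>The quadratic upper bound is applied to each row, with \<open>norm g\<close> bounding
  \<open>row i A \<bullet> g\<close> in the second-order term. Averaging turns the linear terms into
  \<open>- \<eta> * (norm g)\<^sup>2\<close>.\<close>

lemma descent_log:
  fixes A :: "real^'d^'n"
  assumes A: "\<And>i. norm (row i A) \<le> 1" and \<eta>: "0 < \<eta>" "\<eta> \<le> 1"
  shows "risk loss_log A (w - \<eta> *\<^sub>R risk_grad sigmoid A w)
    \<le> risk loss_log A w - \<eta> / 2 * (norm (risk_grad sigmoid A w))\<^sup>2"
proof -
  define g where "g = risk_grad sigmoid A w"
  let ?N = "real CARD('n)"
  have gg: "(norm g)\<^sup>2 = (\<Sum>i\<in>UNIV. sigmoid (row i A \<bullet> w) * (row i A \<bullet> g)) / ?N"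
    unfolding power2_norm_eq_inner g_def by (rule inner_risk_grad)
  have "loss_log (row i A \<bullet> (w - \<eta> *\<^sub>R g)) \<le> loss_log (row i A \<bullet> w)
      - \<eta> * (sigmoid (row i A \<bullet> w) * (row i A \<bullet> g)) + \<eta>\<^sup>2 * (norm g)\<^sup>2 / 2" for i
  proof -
    have "(row i A \<bullet> g)\<^sup>2 \<le> (norm g)\<^sup>2"
      using abs_row_inner_le[OF A] by (simp add: abs_le_square_iff[symmetric])
    then have "\<eta>\<^sup>2 * (row i A \<bullet> g)\<^sup>2 \<le> \<eta>\<^sup>2 * (norm g)\<^sup>2"
      by (intro mult_left_mono) auto
    then show ?thesis
      using loss_log_quadratic[of "row i A \<bullet> (w - \<eta> *\<^sub>R g)" "row i A \<bullet> w"]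
      by (simp add: inner_diff_right power_mult_distrib algebra_simps)
  qed
  then have "risk loss_log A (w - \<eta> *\<^sub>R g) \<le> (\<Sum>i\<in>UNIV. loss_log (row i A \<bullet> w)
      - \<eta> * (sigmoid (row i A \<bullet> w) * (row i A \<bullet> g)) + \<eta>\<^sup>2 * (norm g)\<^sup>2 / 2) / ?N"
    unfolding risk_eq by (intro divide_right_mono sum_mono) auto
  also have "\<dots> = risk loss_log A w - \<eta> * (norm g)\<^sup>2 + \<eta>\<^sup>2 * (norm g)\<^sup>2 / 2"
    unfolding risk_eq gg
    by (simp add: sum.distrib sum_subtractf sum_distrib_left[symmetric] add_divide_distrib diff_divide_distrib)
  also have "\<dots> \<le> risk loss_log A w - \<eta> / 2 * (norm g)\<^sup>2"
  proof -
    \<comment> \<open>Because \<open>\<eta> \<le> 1\<close>, half of the first-order gain pays for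
      the quadratic term.\<close>
    have "\<eta>\<^sup>2 * (norm g)\<^sup>2 \<le> \<eta> * (norm g)\<^sup>2"
      using \<eta> by (intro mult_right_mono) (auto simp: power2_eq_square mult_left_le)
    then show ?thesis by simp
  qed
  finally show ?thesis by (simp add: g_def)
qed

section \<open>Convexity of the risk and elementary properties of the losses\<close>

lemma risk_tangent:
  fixes A :: "real^'d^'n"
  assumes "\<And>a b. l a + l' a * (b - a) \<le> l b"
  shows "risk l A v + risk_grad l' A v \<bullet> (z - v) \<le> risk l A z"
proof -
  have "risk l A v + risk_grad l' A v \<bullet> (z - v)
      = (\<Sum>i\<in>UNIV. l (row i A \<bullet> v) + l' (row i A \<bullet> v) * (row i A \<bullet> z - row i A \<bullet> v)) / real CARD('n)"
    by (simp add: risk_eq inner_risk_grad inner_diff_right right_diff_distrib sum.distrib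
        sum_subtractf add_divide_distrib diff_divide_distrib)
  also have "\<dots> \<le> risk l A z"
    unfolding risk_eq by (intro divide_right_mono sum_mono assms) auto
  finally show ?thesis .
qed

lemma loss_pos:
  assumes "l \<in> {loss_log, loss_exp}"
  shows "0 < l z"
  using assms by (auto simp: loss_log_def loss_exp_def intro!: ln_gt_zero)

lemma loss_le_exp:
  assumes "l \<in> {loss_log, loss_exp}"
  shows "l z \<le> exp z"
  using assms ln_add_one_self_le_self[of "exp z"] by (auto simp: loss_log_def loss_exp_def)

lemma loss_ge_id:
  assumes "l \<in> {loss_log, loss_exp}"
  shows "z \<le> l z"
proof -
  have "ln (exp z) \<le> ln (1 + exp z)"
    by (subst ln_le_cancel_iff) (auto simp: add_pos_pos)
  then show ?thesis
    using assms less_imp_le[OF exp_gt_self[of z]] by (auto simp: loss_log_def loss_exp_def)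
qed

lemma loss_continuous:
  assumes "l \<in> {loss_log, loss_exp}"
  shows "continuous_on X l"
proof -
  have "1 + exp (x::real) \<noteq> 0" for x
    using one_plus_exp_pos[of x] by linarith
  then show ?thesis
    using assms unfolding loss_log_def[abs_def] loss_exp_def[abs_def]
    by (auto intro!: continuous_intros)
qed

text \<open>With \<open>p = exp (a / 2)\<close> and \<open>q = exp (b / 2)\<close> both cases reduce
  to \<open>0 < (p - q) * (p - q)\<close>: for \<open>loss_exp\<close> this is the inequality of
  arithmetic and geometric mean, for \<open>loss_log\<close> it gives
  \<open>(1 + p * q)\<^sup>2 < (1 + p\<^sup>2) * (1 + q\<^sup>2)\<close>. Strictness serves the
  uniqueness of \<open>vbar\<close>.\<close>

lemma loss_strict_midpoint:
  assumes "l \<in> {loss_log, loss_exp}" "a \<noteq> b"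
  shows "l ((a + b) / 2) < (l a + l b) / 2"
proof -
  define p where "p = exp (a / 2)"
  define q where "q = exp (b / 2)"
  have pq: "0 < p" "0 < q" "p \<noteq> q"
    using assms by (auto simp: p_def q_def)
  have e: "exp a = p * p" "exp b = q * q" "exp ((a + b) / 2) = p * q"
    by (auto simp: p_def q_def simp flip: exp_add add_divide_distrib)
  have sq: "0 < (p - q) * (p - q)"
    using pq by (metis not_real_square_gt_zero right_minus_eq)
  have pp: "0 < 1 + p * q" "0 < 1 + p * p" "0 < 1 + q * q"
    using pq by (auto simp: add_pos_pos)
  have "2 * ln (1 + p * q) = ln ((1 + p * q) * (1 + p * q))"
    using pp by (simp add: ln_mult)
  also have "\<dots> < ln ((1 + p * p) * (1 + q * q))"
  proof (rule ln_less_cancel_iff[THEN iffD2])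
    show "(1 + p * q) * (1 + p * q) < (1 + p * p) * (1 + q * q)"
      using sq by (simp add: algebra_simps)
  qed (use pp in simp_all)
  also have "\<dots> = ln (1 + p * p) + ln (1 + q * q)"
    using pp by (simp add: ln_mult)
  finally have "loss_log ((a + b) / 2) < (loss_log a + loss_log b) / 2"
    by (simp add: loss_log_def e)
  moreover have "loss_exp ((a + b) / 2) < (loss_exp a + loss_exp b) / 2"
    using sq by (simp add: loss_exp_def e algebra_simps)
  ultimately show ?thesis using assms by auto
qed

section \<open>Separating direction and the span of the remaining rows\<close>

text \<open>The sum of one witness per row of \<open>rows_c A\<close> works: each such row is
  negative on its own witness and nonpositive on the others. A row of \<open>rows_S A\<close> that
  were negative on a witness would belong to \<open>rows_c A\<close>, so it vanishes on all of
  them.\<close>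

lemma separating_direction:
  fixes A :: "real^'d^'n"
  obtains u where "\<And>i. i \<in> rows_c A \<Longrightarrow> row i A \<bullet> u < 0" "\<And>i. i \<in> rows_S A \<Longrightarrow> row i A \<bullet> u = 0"
proof -
  have "\<forall>i\<in>rows_c A. \<exists>u. (\<forall>k. row k A \<bullet> u \<le> 0) \<and> row i A \<bullet> u < 0"
    by (auto simp: rows_c_def row_inner)
  then obtain U where U: "\<And>i k. i \<in> rows_c A \<Longrightarrow> row k A \<bullet> U i \<le> 0"
      "\<And>i. i \<in> rows_c A \<Longrightarrow> row i A \<bullet> U i < 0"
    by metis
  show ?thesis
  proof
    fix i assume i: "i \<in> rows_c A"
    have "row i A \<bullet> (\<Sum>j\<in>rows_c A. U j) = (\<Sum>j\<in>rows_c A. row i A \<bullet> U j)"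
      by (simp add: inner_sum_right)
    also have "\<dots> < (\<Sum>j\<in>rows_c A. 0)"
      using U i by (intro sum_strict_mono_ex1) auto
    finally show "row i A \<bullet> (\<Sum>j\<in>rows_c A. U j) < 0"
      by simp
  next
    fix i assume i: "i \<in> rows_S A"
    have "row i A \<bullet> U j = 0" if "j \<in> rows_c A" for j
    proof -
      have "\<not> row i A \<bullet> U j < 0"
        using i U(1)[OF that] by (auto simp: rows_S_def rows_c_def row_inner)
      then show ?thesis using U(1)[OF that, of i] by linarith
    qed
    then show "row i A \<bullet> (\<Sum>j\<in>rows_c A. U j) = 0"
      by (simp add: inner_sum_right)
  qed
qed

text \<open>
  Otherwise adding a large multiple of a separating direction to \<open>v\<close> would place row \<open>i\<close> in \<open>A\<^sub>c\<close>.
\<close>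

lemma rows_S_nonpos_imp_zero:
  fixes A :: "real^'d^'n"
  assumes v: "\<And>i. i \<in> rows_S A \<Longrightarrow> row i A \<bullet> v \<le> 0" and i: "i \<in> rows_S A"
  shows "row i A \<bullet> v = 0"
proof (rule ccontr)
  assume "row i A \<bullet> v \<noteq> 0"
  then have neg: "row i A \<bullet> v < 0" using v[OF i] by linarith
  obtain u where u: "\<And>i. i \<in> rows_c A \<Longrightarrow> row i A \<bullet> u < 0" "\<And>i. i \<in> rows_S A \<Longrightarrow> row i A \<bullet> u = 0"
    using separating_direction by blast
  \<comment> \<open>A sum of nonnegative ratios dominates each of them, so
    \<open>M *\<^sub>R u\<close> outweighs \<open>v\<close> on all rows of \<open>rows_c A\<close>
    at once.\<close>
  define M where "M = (\<Sum>k\<in>rows_c A. \<bar>row k A \<bullet> v\<bar> / (- (row k A \<bullet> u)))"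
  have "row k A \<bullet> (v + M *\<^sub>R u) \<le> 0" for k
  proof (cases "k \<in> rows_c A")
    case True
    have "\<bar>row k A \<bullet> v\<bar> / (- (row k A \<bullet> u)) \<le> M"
      unfolding M_def using True u(1)
      by (intro member_le_sum) (auto simp: divide_nonneg_neg less_imp_le intro!: divide_nonneg_pos divide_nonpos_neg)
    then have "\<bar>row k A \<bullet> v\<bar> \<le> M * (- (row k A \<bullet> u))"
      using u(1)[OF True] by (subst (asm) pos_divide_le_eq) auto
    then show ?thesis by (simp add: inner_add_right)
  next
    case False
    then show ?thesis
      using v[of k] u(2)[of k] by (simp add: rows_S_def inner_add_right)
  qed
  moreover have "row i A \<bullet> (v + M *\<^sub>R u) < 0"
    using neg u(2)[OF i] by (simp add: inner_add_right)
  ultimately have "i \<in> rows_c A"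
    by (auto simp: rows_c_def row_inner)
  then show False using i by (simp add: rows_S_def)
qed

lemma orthogonal_span_S:
  assumes "\<And>i. i \<in> rows_S A \<Longrightarrow> row i A \<bullet> u = 0" "v \<in> span_S A"
  shows "u \<bullet> v = 0"
proof -
  have "orthogonal u v"
    using assms(2) unfolding span_S_def
    by (rule orthogonal_to_span) (use assms(1) in \<open>auto simp: orthogonal_def inner_commute\<close>)
  then show ?thesis by (simp add: orthogonal_def)
qed

text \<open>Such a \<open>v\<close> is orthogonal to the whole span, hence to itself. Thus the rows
  in \<open>rows_S A\<close> distinguish the points of \<open>span_S A\<close>.\<close>

lemma span_S_eq_zero:
  assumes "v \<in> span_S A" "\<And>i. i \<in> rows_S A \<Longrightarrow> row i A \<bullet> v = 0"
  shows "v = 0"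
  using orthogonal_span_S[OF assms(2,1)] by simp

lemma row_in_span_S: "i \<in> rows_S A \<Longrightarrow> row i A \<in> span_S A"
  by (auto simp: span_S_def intro: span_base)

lemma subspace_span_S: "subspace (span_S A)"
  by (simp add: span_S_def)

section \<open>Coercivity on the span and the minimizer \<open>vbar\<close>\<close>

abbreviation loss_S :: "(real \<Rightarrow> real) \<Rightarrow> real^'d^'n \<Rightarrow> real^'d \<Rightarrow> real" where
  "loss_S l A v \<equiv> total_loss l (rows_S A) (A *v v)"

lemma loss_S_eq: "loss_S l A v = (\<Sum>i\<in>rows_S A. l (row i A \<bullet> v))"
  by (simp add: total_loss_def row_inner)

text \<open>The sum \<open>f\<close> of positive parts lies below the loss, is positively
  homogeneous and, by \<open>rows_S_nonpos_imp_zero\<close>, positive at nonzero points of the span.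
  Its minimum over the compact unit sphere of the span is a valid \<open>\<delta>\<close>.\<close>

lemma loss_S_coercive:
  fixes A :: "real^'d^'n"
  assumes l: "l \<in> {loss_log, loss_exp}"
  obtains \<delta> where "0 < \<delta>" "\<And>v. v \<in> span_S A \<Longrightarrow> \<delta> * norm v \<le> loss_S l A v"
proof -
  define f where "f = (\<lambda>v. \<Sum>i\<in>rows_S A. max 0 (row i A \<bullet> v))"
  have f_scale: "f (c *\<^sub>R v) = c * f v" if "0 \<le> c" for c v
    unfolding f_def sum_distrib_left using that
    by (intro sum.cong) (auto simp: max_def mult_le_0_iff zero_le_mult_iff)
  have f_pos: "0 < f v" if "v \<in> span_S A" "v \<noteq> 0" for v
  proof (rule ccontr)
    assume "\<not> 0 < f v"
    moreover have "row i A \<bullet> v \<le> f v" if "i \<in> rows_S A" for i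
    proof -
      have "max 0 (row i A \<bullet> v) \<le> f v"
        unfolding f_def using that by (intro member_le_sum) auto
      then show ?thesis by simp
    qed
    ultimately have "row i A \<bullet> v \<le> 0" if "i \<in> rows_S A" for i
      using that by fastforce
    then have "v = 0"
      using that(1) by (intro span_S_eq_zero[of v A] rows_S_nonpos_imp_zero)
    then show False using that(2) by simp
  qed
  have cont: "continuous_on X f" for X
    unfolding f_def by (intro continuous_intros)
  let ?K = "sphere 0 1 \<inter> span_S A"
  have comp: "compact ?K"
    unfolding span_S_def by (intro compact_Int_closed closed_span) auto
  obtain \<delta> where \<delta>: "0 < \<delta>" "\<And>v. v \<in> ?K \<Longrightarrow> \<delta> \<le> f v"
  \<comment> \<open>The sphere is empty when \<open>span_S A\<close> is trivial; any positive
    \<open>\<delta>\<close> then serves.\<close>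
  proof (cases "?K = {}")
    case False
    then obtain v where v: "v \<in> ?K" "\<And>v'. v' \<in> ?K \<Longrightarrow> f v \<le> f v'"
      using continuous_attains_inf[OF comp _ cont] by blast
    then have "0 < f v" by (intro f_pos) auto
    then show ?thesis using that v(2) by blast
  qed (use that[of 1] in auto)
  show ?thesis
  proof (rule that[OF \<delta>(1)])
    fix v assume v: "v \<in> span_S A"
    have "\<delta> * norm v \<le> f v"
    proof (cases "v = 0")
      case False
      have "(1 / norm v) *\<^sub>R v \<in> ?K"
        using v False subspace_span_S[of A] by (auto simp: subspace_scale)
      then have "\<delta> \<le> f ((1 / norm v) *\<^sub>R v)"
        by (rule \<delta>(2))
      also have "\<dots> = 1 / norm v * f v"
        by (rule f_scale) simp
      finally show ?thesis
        using False by (simp add: field_simps)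
    qed (simp add: f_def)
    also have "\<dots> \<le> loss_S l A v"
      unfolding f_def loss_S_eq using loss_pos[OF l] loss_ge_id[OF l]
      by (intro sum_mono) (simp add: less_imp_le)
    finally show "\<delta> * norm v \<le> loss_S l A v" .
  qed
qed

text \<open>As \<open>vbar\<close> is a definite description, existence and uniqueness are both
  required. Coercivity confines the search to a compact set, and strict midpoint convexity excludes
  a second minimizer.\<close>

lemma vbar_minimizer:
  fixes A :: "real^'d^'n"
  assumes l: "l \<in> {loss_log, loss_exp}"
  shows "vbar l A \<in> span_S A" "\<And>v. v \<in> span_S A \<Longrightarrow> loss_S l A (vbar l A) \<le> loss_S l A v"
proof -
  obtain \<delta> where \<delta>: "0 < \<delta>" "\<And>v. v \<in> span_S A \<Longrightarrow> \<delta> * norm v \<le> loss_S l A v"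
    using loss_S_coercive[OF l] by blast
  \<comment> \<open>At points of the span outside the ball of radius \<open>r\<close>, the coercive
    bound alone exceeds the loss at 0.\<close>
  define r where "r = loss_S l A 0 / \<delta>"
  let ?K = "cball 0 r \<inter> span_S A"
  have "0 \<le> loss_S l A 0"
    unfolding loss_S_eq using loss_pos[OF l] by (intro sum_nonneg) (simp add: less_imp_le)
  then have zero: "0 \<in> ?K"
    using \<delta>(1) subspace_0[OF subspace_span_S] by (auto simp: r_def)
  have comp: "compact ?K"
    unfolding span_S_def by (intro compact_Int_closed closed_span) auto
  have cont: "continuous_on ?K (loss_S l A)"
    unfolding loss_S_eq
    by (intro continuous_intros continuous_on_compose2[OF loss_continuous[OF l, of UNIV]]) auto
  obtain m where m: "m \<in> ?K" "\<And>v. v \<in> ?K \<Longrightarrow> loss_S l A m \<le> loss_S l A v"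
    using continuous_attains_inf[OF comp _ cont] zero by blast
  have min: "loss_S l A m \<le> loss_S l A v" if v: "v \<in> span_S A" for v
  proof (cases "v \<in> ?K")
    case False
    then have "loss_S l A 0 \<le> \<delta> * norm v"
      using v \<delta>(1) by (auto simp: r_def field_simps)
    then show ?thesis using \<delta>(2)[OF v] m(2)[OF zero] by linarith
  qed (use m in auto)
  let ?P = "is_arg_min (loss_S l A) (\<lambda>v. v \<in> span_S A)"
  have "?P m"
    using m min by (auto simp: is_arg_min_linorder)
  moreover have "v = m" if "?P v" for v
  proof (rule ccontr)
    assume "v \<noteq> m"
    have v: "v \<in> span_S A" "loss_S l A v \<le> loss_S l A m"
      using that m(1) by (auto simp: is_arg_min_linorder)
    define c where "c = (1 / 2) *\<^sub>R (v + m)"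
    have c: "c \<in> span_S A"
      using v m(1) subspace_span_S[of A] by (auto simp: c_def subspace_add subspace_scale)
    have ci: "row i A \<bullet> c = (row i A \<bullet> v + row i A \<bullet> m) / 2" for i
      by (simp add: c_def inner_add_right)
    \<comment> \<open>A nonzero vector of the span is detected by some row in
      \<open>rows_S A\<close>; on that row the midpoint inequality is strict.\<close>
    have "v - m \<in> span_S A"
      using v m(1) subspace_span_S[of A] by (auto simp: subspace_diff)
    then obtain k where k: "k \<in> rows_S A" "row k A \<bullet> v \<noteq> row k A \<bullet> m"
      using span_S_eq_zero[of "v - m" A] \<open>v \<noteq> m\<close> by (auto simp: inner_diff_right)
    have "l (row i A \<bullet> c) \<le> (l (row i A \<bullet> v) + l (row i A \<bullet> m)) / 2" for i
      using loss_strict_midpoint[OF l, of "row i A \<bullet> v" "row i A \<bullet> m"]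
      by (cases "row i A \<bullet> v = row i A \<bullet> m") (auto simp: ci)
    then have "loss_S l A c < (\<Sum>i\<in>rows_S A. (l (row i A \<bullet> v) + l (row i A \<bullet> m)) / 2)"
      unfolding loss_S_eq using k loss_strict_midpoint[OF l k(2)]
      by (intro sum_strict_mono_ex1) (auto simp: ci)
    also have "\<dots> = (loss_S l A v + loss_S l A m) / 2"
      by (simp add: loss_S_eq sum.distrib flip: sum_divide_distrib)
    also have "\<dots> \<le> loss_S l A m"
      using v(2) by simp
    finally show False using min[OF c] by simp
  qed
  ultimately have "vbar l A = m"
    unfolding vbar_def by (rule the_equality)
  then show "vbar l A \<in> span_S A" "\<And>v. v \<in> span_S A \<Longrightarrow> loss_S l A (vbar l A) \<le> loss_S l A v"
    using m min by auto
qed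

section \<open>Orthogonal decomposition and the margin\<close>

lemma span_S_decomp:
  obtains a b where "u = a + b" "a \<in> span_S A" "b \<in> orthogonal_comp (span_S A)"
proof -
  have "u \<in> span_S A + orthogonal_comp (span_S A)"
    by (simp add: subspace_sum_orthogonal_comp[OF subspace_span_S])
  then show ?thesis using that set_plus_elim by blast
qed

lemma orthogonal_comp_inner: "x \<in> orthogonal_comp T \<Longrightarrow> y \<in> T \<Longrightarrow> y \<bullet> x = 0"
  by (auto simp: orthogonal_comp_def orthogonal_def)

lemma orth_proj_eqI:
  assumes "subspace T" "p \<in> T" "\<And>y. y \<in> T \<Longrightarrow> orthogonal (x - p) y"
  shows "orth_proj T x = p"
  unfolding orth_proj_def
proof (rule the_equality)
  fix q assume q: "q \<in> T \<and> (\<forall>y\<in>T. orthogonal (x - q) y)"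
  then have "p - q \<in> T"
    using assms by (auto simp: subspace_diff)
  then have "(x - q) \<bullet> (p - q) - (x - p) \<bullet> (p - q) = 0"
    using q assms(3) by (simp add: orthogonal_def)
  then have "(p - q) \<bullet> (p - q) = 0"
    by (simp add: inner_diff_left)
  then show "q = p" by simp
qed (use assms in auto)

text \<open>The orthogonal projection can be moved from the row to the vector, where it leaves only
  \<open>b\<close>. Hence \<open>A_perp A\<close> need not be computed: the original rows act on the
  complement in the same way.\<close>

lemma A_perp_inner:
  assumes "a \<in> span_S A" "b \<in> orthogonal_comp (span_S A)"
  shows "(A_perp A *v (a + b)) $ i = row i A \<bullet> b"
proof -
  obtain r p where rp: "row i A = r + p" "r \<in> span_S A" "p \<in> orthogonal_comp (span_S A)"
    using span_S_decomp by blast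
  have "orth_proj (orthogonal_comp (span_S A)) (row i A) = p"
    using rp by (intro orth_proj_eqI subspace_orthogonal_comp)
      (auto simp: orthogonal_def orthogonal_comp_inner)
  then have "(A_perp A *v (a + b)) $ i = p \<bullet> (a + b)"
    by (simp add: matrix_vector_mul_component A_perp_def)
  also have "\<dots> = row i A \<bullet> b"
    using rp assms orthogonal_comp_inner[of p _ a] orthogonal_comp_inner[of b _ r]
    by (simp add: inner_add_right inner_add_left inner_commute)
  finally show ?thesis .
qed

lemma continuous_on_Max:
  fixes f :: "'i \<Rightarrow> 'a::topological_space \<Rightarrow> 'b::linorder_topology"
  assumes "finite I" "I \<noteq> {}" "\<And>i. i \<in> I \<Longrightarrow> continuous_on X (f i)"
  shows "continuous_on X (\<lambda>x. MAX i\<in>I. f i x)"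
  using assms
proof (induction I rule: finite_ne_induct)
  case (insert i I)
  then have "(MAX j\<in>insert i I. f j x) = max (f i x) (MAX j\<in>I. f j x)" for x
    by simp
  with insert show ?case
    by (simp add: continuous_on_max)
qed auto

text \<open>The unit vector attaining the minimum in \<open>margin\<close> is replaced by its
  component orthogonal to the span, which has norm at most 1 and the same products with the rows of
  \<open>A_perp A\<close>. The margin is positive because a normalized separating direction already
  makes the maximum negative.\<close>

lemma margin_direction:
  fixes A :: "real^'d^'n"
  assumes ne: "rows_c A \<noteq> {}"
  obtains u where "0 < margin A" "norm u \<le> 1" "u \<in> orthogonal_comp (span_S A)"
    "\<And>i. i \<in> rows_c A \<Longrightarrow> row i A \<bullet> u \<le> - margin A"
proof -
  define f where "f = (\<lambda>u. MAX i\<in>rows_c A. (A_perp A *v u) $ i)"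
  have f_iff: "f u \<le> c \<longleftrightarrow> (\<forall>i\<in>rows_c A. (A_perp A *v u) $ i \<le> c)"
       "f u < c \<longleftrightarrow> (\<forall>i\<in>rows_c A. (A_perp A *v u) $ i < c)" for u c
    using ne by (auto simp: f_def)
  have cont: "continuous_on X f" for X
    unfolding f_def using ne
    by (intro continuous_on_Max) (auto simp: row_inner intro!: continuous_intros)
  let ?K = "{u::real^'d. norm u = 1}"
  have K: "?K = sphere 0 1" by (auto simp: sphere_def)
  have comp: "compact ?K" unfolding K by simp
  have "?K \<noteq> {}" unfolding K by simp
  then obtain m where m: "norm m = 1" "\<And>u. norm u = 1 \<Longrightarrow> f m \<le> f u"
    using continuous_attains_inf[OF comp _ cont] by blast
  have "(INF u\<in>?K. f u) = f m"
    using m by (intro cInf_eq_minimum) auto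
  then have margin: "margin A = - f m"
    by (simp add: margin_def f_def)
  obtain u where u: "\<And>i. i \<in> rows_c A \<Longrightarrow> row i A \<bullet> u < 0" "\<And>i. i \<in> rows_S A \<Longrightarrow> row i A \<bullet> u = 0"
    using separating_direction by blast
  have "u \<noteq> 0" using ne u(1) by force
  let ?u = "(1 / norm u) *\<^sub>R u"
  have "?u \<in> orthogonal_comp (span_S A)"
    using orthogonal_span_S[OF u(2)] by (auto simp: orthogonal_comp_def orthogonal_def inner_commute)
  from A_perp_inner[OF subspace_0[OF subspace_span_S] this]
  have "(A_perp A *v ?u) $ i = row i A \<bullet> ?u" for i
    by simp
  then have "f ?u < 0"
    unfolding f_iff using u(1) \<open>u \<noteq> 0\<close> by (auto simp: divide_neg_pos)
  moreover have "f m \<le> f ?u"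
    using \<open>u \<noteq> 0\<close> by (intro m) simp
  ultimately have pos: "0 < margin A"
    using margin by simp
  obtain a b where ab: "m = a + b" "a \<in> span_S A" "b \<in> orthogonal_comp (span_S A)"
    using span_S_decomp by blast
  have "row i A \<bullet> b \<le> - margin A" if "i \<in> rows_c A" for i
    using that f_iff(1)[of m "f m"] A_perp_inner[OF ab(2,3)] by (simp add: margin ab(1))
  moreover have "norm b \<le> 1"
  proof -
    have "(norm m)\<^sup>2 = (norm a)\<^sup>2 + (norm b)\<^sup>2"
      using orthogonal_comp_inner[OF ab(3,2)] ab(1) 
      by (simp add: norm_add_Pythagorean orthogonal_def)
    then have "(norm b)\<^sup>2 \<le> 1"
      using m(1) zero_le_power2[of "norm a"] by (simp only: one_power2)
    then show ?thesis by (simp add: power_le_one_iff)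
  qed
  ultimately show ?thesis using that pos ab(3) by blast
qed

section \<open>Comparison point and the final bound\<close>

text \<open>Common interface to the two losses for the main argument. The premise
  \<open>risk l A v \<le> 1\<close> is the one that \<open>descent_exp\<close> requires.\<close>

lemma loss_gradient_properties:
  fixes A :: "real^'d^'n"
  assumes A: "\<And>i. norm (row i A) \<le> 1" and l: "l \<in> {loss_log, loss_exp}"
  obtains g where "\<And>v. gradient (risk l A) v = g v"
    "\<And>v z. risk l A v + g v \<bullet> (z - v) \<le> risk l A z"
    "\<And>v \<eta>. risk l A v \<le> 1 \<Longrightarrow> 0 < \<eta> \<Longrightarrow> \<eta> \<le> 1
      \<Longrightarrow> risk l A (v - \<eta> *\<^sub>R g v) \<le> risk l A v - \<eta> / 2 * (norm (g v))\<^sup>2"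
proof -
  consider "l = loss_log" | "l = loss_exp" using l by auto
  then show ?thesis
  proof cases
    case 1
    show ?thesis
      by (rule that[unfolded 1])
        (rule gradient_risk[OF DERIV_loss_log] risk_tangent[OF loss_log_tangent] descent_log[OF A];
          assumption)+
  next
    case 2
    have D: "DERIV loss_exp z :> exp z" for z
      by (simp add: loss_exp_def[abs_def])
    have T: "loss_exp a + exp a * (b - a) \<le> loss_exp b" for a b
    proof -
      have "exp a * (1 + (b - a)) \<le> exp a * exp (b - a)"
        by (intro mult_left_mono exp_ge_add_one_self) simp
      then show ?thesis
        by (simp add: loss_exp_def algebra_simps flip: exp_add)
    qed
    show ?thesis
      by (rule that[unfolded 2])
        (fact gradient_risk[OF D] risk_tangent[OF T] descent_exp[OF A])+
  qed
qed

text \<open>The risk at 0 is \<open>l 0\<close>, which is 1 or \<open>ln 2\<close>. This starts the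
  induction that keeps the iterates in the region where descent holds.\<close>

lemma risk_zero_le_one:
  fixes A :: "real^'d^'n"
  assumes "l \<in> {loss_log, loss_exp}"
  shows "risk l A 0 \<le> 1"
proof -
  have "risk l A 0 = l 0"
    by (simp add: risk_eq)
  then show ?thesis using loss_le_exp[OF assms, of 0] by simp
qed

text \<open>The component of \<open>u\<close> orthogonal to the span leaves the losses of
  \<open>rows_S A\<close> unchanged, and dropping the positive losses of \<open>rows_c A\<close>
  only lowers the sum.\<close>

lemma loss_S_vbar_le_INF_risk:
  fixes A :: "real^'d^'n"
  assumes l: "l \<in> {loss_log, loss_exp}"
  shows "loss_S l A (vbar l A) / real CARD('n) \<le> (INF u. risk l A u)"
proof (rule cINF_greatest)
  fix u :: "real^'d"
  obtain a b where ab: "u = a + b" "a \<in> span_S A" "b \<in> orthogonal_comp (span_S A)"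
    using span_S_decomp by blast
  have "loss_S l A (vbar l A) \<le> loss_S l A a"
    by (rule vbar_minimizer(2)[OF l ab(2)])
  also have "\<dots> = loss_S l A u"
    unfolding loss_S_eq ab(1)
    by (intro sum.cong refl) (simp add: inner_add_right orthogonal_comp_inner[OF ab(3) row_in_span_S])
  also have "\<dots> \<le> (\<Sum>i\<in>UNIV. l (row i A \<bullet> u))"
    unfolding loss_S_eq using loss_pos[OF l] by (intro sum_mono2) (auto simp: less_imp_le)
  finally show "loss_S l A (vbar l A) / real CARD('n) \<le> risk l A u"
    by (simp add: risk_eq divide_right_mono)
qed simp

text \<open>The shift is orthogonal to \<open>vbar l A\<close>, so the squared norms add. A row of
  \<open>rows_c A\<close> has product at most \<open>norm (vbar l A)\<close> with
  \<open>vbar l A\<close> and at most \<open>- ln t\<close> with the shift, which makes its loss at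
  most \<open>exp (norm (vbar l A)) / t\<close>.\<close>

lemma comparator:
  fixes A :: "real^'d^'n"
  assumes A: "\<And>i. norm (row i A) \<le> 1" and l: "l \<in> {loss_log, loss_exp}" and t: "1 \<le> t"
  obtains z where
    "(norm z)\<^sup>2 \<le> (norm (vbar l A))\<^sup>2 + (if rows_c A = {} then 0 else (ln t)\<^sup>2 / (margin A)\<^sup>2)"
    "risk l A z \<le> (INF u. risk l A u) + exp (norm (vbar l A)) / t"
proof -
  have "\<exists>u. u \<in> orthogonal_comp (span_S A) \<and> (\<forall>i\<in>rows_c A. row i A \<bullet> u \<le> - ln t)
      \<and> (norm u)\<^sup>2 \<le> (if rows_c A = {} then 0 else (ln t)\<^sup>2 / (margin A)\<^sup>2)"
  proof (cases "rows_c A = {}")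
    case True
    \<comment> \<open>Without rows in \<open>rows_c A\<close> the zero shift meets the norm bound
      0.\<close>
    then show ?thesis
      by (intro exI[of _ 0]) (simp add: subspace_0 subspace_orthogonal_comp)
  next
    case False
    obtain u where u: "0 < margin A" "norm u \<le> 1" "u \<in> orthogonal_comp (span_S A)"
      "\<And>i. i \<in> rows_c A \<Longrightarrow> row i A \<bullet> u \<le> - margin A"
      using margin_direction[OF False] by blast
    \<comment> \<open>This scale turns the bound \<open>- margin A\<close> on the products into
      \<open>- ln t\<close>; it is nonnegative since \<open>1 \<le> t\<close>.\<close>
    let ?c = "ln t / margin A"
    have "0 \<le> ?c" using t u(1) by simp
    have "row i A \<bullet> (?c *\<^sub>R u) \<le> - ln t" if "i \<in> rows_c A" for i
      using mult_left_mono[OF u(4)[OF that] \<open>0 \<le> ?c\<close>] u(1) by simp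
    moreover have "(norm (?c *\<^sub>R u))\<^sup>2 \<le> (ln t)\<^sup>2 / (margin A)\<^sup>2"
    proof -
      have "norm (?c *\<^sub>R u) \<le> ?c"
        using mult_left_mono[OF u(2) \<open>0 \<le> ?c\<close>] \<open>0 \<le> ?c\<close> by (simp only: norm_scaleR abs_of_nonneg mult_1_right)
      then have "(norm (?c *\<^sub>R u))\<^sup>2 \<le> ?c\<^sup>2"
        by (rule power_mono) simp
      then show ?thesis by (simp only: power_divide)
    qed
    ultimately show ?thesis
      using False subspace_scale[OF subspace_orthogonal_comp u(3), of ?c] by auto
  qed
  then obtain u where u: "u \<in> orthogonal_comp (span_S A)" "\<And>i. i \<in> rows_c A \<Longrightarrow> row i A \<bullet> u \<le> - ln t"
      "(norm u)\<^sup>2 \<le> (if rows_c A = {} then 0 else (ln t)\<^sup>2 / (margin A)\<^sup>2)"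
    by blast
  let ?v = "vbar l A"
  have v: "?v \<in> span_S A" by (rule vbar_minimizer(1)[OF l])
  show ?thesis
  proof
    have "(norm (?v + u))\<^sup>2 = (norm ?v)\<^sup>2 + (norm u)\<^sup>2"
      using orthogonal_comp_inner[OF u(1) v] by (simp add: norm_add_Pythagorean orthogonal_def)
    then show "(norm (?v + u))\<^sup>2
        \<le> (norm ?v)\<^sup>2 + (if rows_c A = {} then 0 else (ln t)\<^sup>2 / (margin A)\<^sup>2)"
      using u(3) by linarith
  next
    let ?N = "real CARD('n)"
    have S: "l (row i A \<bullet> (?v + u)) = l (row i A \<bullet> ?v)" if "i \<in> rows_S A" for i
      using orthogonal_comp_inner[OF u(1) row_in_span_S[OF that]] by (simp add: inner_add_right)
    have c: "l (row i A \<bullet> (?v + u)) \<le> exp (norm ?v) / t" if "i \<in> rows_c A" for i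
    proof -
      have "row i A \<bullet> (?v + u) \<le> norm ?v - ln t"
        using abs_row_inner_le[OF A, of i ?v] u(2)[OF that] by (simp add: inner_add_right)
      then have "exp (row i A \<bullet> (?v + u)) \<le> exp (norm ?v - ln t)"
        by simp
      also have "\<dots> = exp (norm ?v) / t"
        using t by (simp add: exp_diff)
      finally show ?thesis using loss_le_exp[OF l] order_trans by blast
    qed
    have "(\<Sum>i\<in>UNIV. l (row i A \<bullet> (?v + u)))
        = (\<Sum>i\<in>rows_S A. l (row i A \<bullet> (?v + u))) + (\<Sum>i\<in>rows_c A. l (row i A \<bullet> (?v + u)))"
      by (subst sum.union_disjoint[symmetric]) (auto simp: rows_S_def intro!: sum.cong)
    also have "\<dots> \<le> loss_S l A ?v + (\<Sum>i\<in>rows_c A. exp (norm ?v) / t)"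
      unfolding loss_S_eq by (intro add_mono sum_mono c) (simp add: S)
    \<comment> \<open>At most \<open>?N\<close> rows lie in \<open>rows_c A\<close>, so the later
      division by \<open>?N\<close> leaves a single \<open>exp (norm ?v) / t\<close>.\<close>
    also have "\<dots> \<le> loss_S l A ?v + ?N * (exp (norm ?v) / t)"
      using t by (auto intro!: mult_right_mono divide_right_mono card_mono)
    finally have "risk l A (?v + u) \<le> (loss_S l A ?v + ?N * (exp (norm ?v) / t)) / ?N"
      unfolding risk_eq by (rule divide_right_mono) simp
    also have "\<dots> = loss_S l A ?v / ?N + exp (norm ?v) / t"
      by (simp add: add_divide_distrib)
    finally show "risk l A (?v + u) \<le> (INF u. risk l A u) + exp (norm ?v) / t"
      using loss_S_vbar_le_INF_risk[OF l, of A] by linarith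
  qed
qed

theorem theorem3p1:
  fixes x :: "'n::finite \<Rightarrow> real^'d" and y :: "'n \<Rightarrow> real" and A :: "real^'d^'n"
    and l :: "real \<Rightarrow> real" and w :: "nat \<Rightarrow> real^'d" and \<eta> :: "nat \<Rightarrow> real" and t :: nat
  assumes "\<And>i. row i A = - y i *\<^sub>R x i"
    and "\<And>i. norm (row i A) \<le> 1"
    and "l \<in> {loss_log, loss_exp}"
    and "w 0 = 0"
    and "\<And>j. w (Suc j) = w j - \<eta> j *\<^sub>R gradient (risk l A) (w j)"
    and "\<And>j. 0 < \<eta> j \<and> \<eta> j \<le> 1"
    and "t \<ge> 1"
  shows "risk l A (w t) - (INF u. risk l A u)
    \<le> exp (norm (vbar l A)) / real t
      + ((norm (vbar l A))\<^sup>2 + (if rows_c A = {} then 0 else (ln (real t))\<^sup>2 / (margin A)\<^sup>2))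
        / (2 * (\<Sum>j<t. \<eta> j))"
proof -
  obtain g where g: "\<And>v. gradient (risk l A) v = g v"
    and tangent: "\<And>v z. risk l A v + g v \<bullet> (z - v) \<le> risk l A z"
    and descent: "\<And>v \<eta>. risk l A v \<le> 1 \<Longrightarrow> 0 < \<eta> \<Longrightarrow> \<eta> \<le> 1
      \<Longrightarrow> risk l A (v - \<eta> *\<^sub>R g v) \<le> risk l A v - \<eta> / 2 * (norm (g v))\<^sup>2"
    using loss_gradient_properties[OF assms(2,3)] by blast
  have step: "w (Suc j) = w j - \<eta> j *\<^sub>R g (w j)" for j
    by (simp add: assms(5) g)
  have dec: "risk l A (w (Suc j)) \<le> risk l A (w j) - \<eta> j / 2 * (norm (g (w j)))\<^sup>2"
    if "risk l A (w j) \<le> 1" for j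
    unfolding step using descent that assms(6) by blast
  \<comment> \<open>Each descent step preserves the risk bound that the next one presupposes, so the
    descent inequality is available at every iterate.\<close>
  have le_one: "risk l A (w j) \<le> 1" for j
  proof (induction j)
    case (Suc j)
    have "0 \<le> \<eta> j / 2 * (norm (g (w j)))\<^sup>2"
      using assms(6)[of j] by simp
    then show ?case using dec[OF Suc] Suc by linarith
  qed (simp add: assms(4) risk_zero_le_one[OF assms(3)])
  obtain z where z:
    "(norm z)\<^sup>2 \<le> (norm (vbar l A))\<^sup>2
      + (if rows_c A = {} then 0 else (ln (real t))\<^sup>2 / (margin A)\<^sup>2)" (is "_ \<le> ?Q")
    "risk l A z \<le> (INF u. risk l A u) + exp (norm (vbar l A)) / real t"
    using comparator[of A l "real t"] assms(2,3,7) by (metis of_nat_1 of_nat_le_iff)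
  have "risk l A (w t) - risk l A z \<le> (norm (w 0 - z))\<^sup>2 / (2 * (\<Sum>j<t. \<eta> j))"
  proof (rule descent_telescoping[where g = g])
    show "0 < \<eta> j" for j using assms(6) by blast
  qed (fact step dec[OF le_one] tangent assms(7))+
  also have "\<dots> \<le> ?Q / (2 * (\<Sum>j<t. \<eta> j))"
    using z(1) assms(6) by (intro divide_right_mono) (auto simp: assms(4) less_imp_le intro!: sum_nonneg)
  finally show ?thesis
    using z(2) by linarith
qed

end
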